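(* For $s\in(0,\tfrac18)$ put $a=1-\sqrt{2s}\in(\tfrac12,1)$ and $\bar r(a)=\frac{1-2a+\sqrt{4a^2-4a+9}}{4}$, and for $r\in[0,\bar r(a)]$ let $\pi_1,\pi_2$ be the equilibrium profits of the prominent firm (Firm 1) and the non-prominent firm (Firm 2). Then: 1. For every $s\in(0,\tfrac18)$, $\pi_1$ strictly decreases as $r$ increases over $[0,\bar r(a)]$. 2. When the search cost is relatively low or the return cost is high enough, $\pi_2$ strictly decreases as $r$ increases; that is: (i) there exists $\bar s\in(0,\tfrac18)$ such that for every $s\in(0,\bar s)$, $\pi_2$ is strictly decreasing in $r$ on $[0,\bar r(a)]$; and (ii) for every $s\in(0,\tfrac18)$ there exists $\tilde r<\bar r(a)$, $\tilde r\geq 0$, such that $\pi_2$ is strictly decreasing in $r$ on $[\tilde r,\bar r(a)]$. 3. For every $s\in(0,\tfrac18)$, the industry profit $\pi_1+\pi_2$ strictly decreases as $r$ increases over $[0,\bar r(a)]$.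
   Context: Two firms sell one product each at zero marginal cost. Consumers (unit mass) have match values $u_1,u_2$, i.i.d. uniform on $[0,1]$. Firm 1 is prominent (searched and bought first, at no search cost); searching and buying product 2 costs $s\in(0,1/8)$; returned units are fully refunded and cost the firm $r$ each. Prices are not observed before search, so search decisions depend on the actual $p_1$ and the expected (equilibrium) price $p_2$: with $a=1-\sqrt{2s}$, a consumer buys product 2 iff $u_1<a+p_1-p_2$. Given a candidate pair $(p_1,p_2)$, the deviation profits are as follows. If Firm 1 charges $p$ instead of $p_1$, $$\pi_1(p)=(p+r)\Big[1-(a+p-p_2)+\tfrac12(a^2-p_2^2)\Big]-r .$$ If Firm 2 charges $p$ instead of $p_2$ (consumers still expect $p_2$ when deciding whether to search), $$\pi_2(p)=(p+r)\Big[(a+p_1-p_2)\big(1-(a+p-p_2)\big)+\tfrac12(a-p_2)(a-p_2+2p_1)\Big]-r(a+p_1-p_2).$$ A pair $(p_1,p_2)$ of nonnegative prices is an equilibrium if $p_1$ maximizes $\pi_1(\cdot)$ over $p\ge0$ and $p_2$ maximizes $\pi_2(\cdot)$ over $p\ge 0$. For each $r\in[0,1]$ the paper shows there is exactly one equilibrium with $p_1,p_2\in[0,\frac{1-r}{2}]$; this is "the" equilibrium. Equilibrium profits are $\pi_1=\pi_1(p_1)$ and $\pi_2=\pi_2(p_2)$ evaluated at it. *)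

theory Defs
  imports "HOL-Analysis.Analysis"
begin

(* The reservation match value: the search cost s balances the expected gain
   (1 - a)^2 / 2 from searching product 2 with a uniform match value on [0,1]. *)
definition reservation_value :: "real \<Rightarrow> real" where
  "reservation_value s = 1 - sqrt (2 * s)"

definition r_bar :: "real \<Rightarrow> real" where
  "r_bar a = (1 - 2 * a + sqrt (4 * a\<^sup>2 - 4 * a + 9)) / 4"

(* Profit of Firm 1 (prominent) when it charges p. Consumers observe p before deciding
   whether to search, so only the expected price p2 of the rival enters. *)
definition profit1 :: "real \<Rightarrow> real \<Rightarrow> real \<Rightarrow> real \<Rightarrow> real" where
  "profit1 a r p2 p =
     (p + r) * (1 - (a + p - p2) + (a\<^sup>2 - p2\<^sup>2) / 2) - r"

(* Profit of Firm 2 when it charges p while consumers, who observe p1 but not p,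
   expect p2: a consumer buys product 2 iff u1 < a + p1 - p2, independently of p. *)
definition profit2 :: "real \<Rightarrow> real \<Rightarrow> real \<Rightarrow> real \<Rightarrow> real \<Rightarrow> real" where
  "profit2 a r p1 p2 p =
     (p + r) * ((a + p1 - p2) * (1 - (a + p - p2)) + (a - p2) * (a - p2 + 2 * p1) / 2)
       - r * (a + p1 - p2)"

definition is_equilibrium :: "real \<Rightarrow> real \<Rightarrow> real \<Rightarrow> real \<Rightarrow> bool" where
  "is_equilibrium a r p1 p2 \<longleftrightarrow>
     is_arg_max (profit1 a r p2) (\<lambda>p. 0 \<le> p) p1 \<and>
     is_arg_max (profit2 a r p1 p2) (\<lambda>p. 0 \<le> p) p2"

(* The box [0,(1 - r)/2]^2 is the range in which the equilibrium is unique (for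
   0 < s < 1/8 and 0 \<le> r \<le> 1); it excludes degenerate equilibria in which product 2
   is never searched. *)
definition equilibrium :: "real \<Rightarrow> real \<Rightarrow> real \<times> real" where
  "equilibrium a r =
     (THE (p1, p2). p1 \<in> {0..(1 - r) / 2} \<and> p2 \<in> {0..(1 - r) / 2} \<and> is_equilibrium a r p1 p2)"

definition eq_profit1 :: "real \<Rightarrow> real \<Rightarrow> real" where
  "eq_profit1 a r = (case equilibrium a r of (p1, p2) \<Rightarrow> profit1 a r p2 p1)"

definition eq_profit2 :: "real \<Rightarrow> real \<Rightarrow> real" where
  "eq_profit2 a r = (case equilibrium a r of (p1, p2) \<Rightarrow> profit2 a r p1 p2 p2)"

end

theory Submission
  imports Defs
begin

text \<open>Raising \<open>r\<close> to \<open>r'\<close> weakly lowers both equilibrium prices, and \<open>p2\<close> by at most \<open>r' - r\<close>.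
  A lower \<open>p2\<close> takes demand from Firm 1, so \<open>\<pi>\<^sub>1\<close> falls by revealed preference. For \<open>\<pi>\<^sub>2\<close> the
  only effect of the wrong sign is that a lower expected \<open>p2\<close> invites more searches; per unit
  of \<open>p2\<close> it is worth at most \<open>p2 * (1 - a) - r * a\<close>, which is less than the direct loss
  \<open>q * (1 - p2 - r)\<close> on the \<open>q = a + p1 - p2\<close> units shipped. Hence \<open>\<pi>\<^sub>2\<close> in fact decreases on
  all of \<open>[0, r_bar a]\<close> for every \<open>s\<close>; of \<open>r_bar\<close> only the bound \<open>r_bar a < 1 - a / 2\<close> matters.\<close>

section \<open>Best responses of the two firms\<close>

lemma is_arg_max_concave_quadratic_iff:
  fixes f :: "real \<Rightarrow> real"
  assumes "k > 0" and f: "\<And>p. f p = K - k * (p - m)\<^sup>2"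
  shows "is_arg_max f (\<lambda>p. 0 \<le> p) x \<longleftrightarrow> x = max 0 m"
proof -
  have le: "f y \<le> f x \<longleftrightarrow> \<bar>x - m\<bar> \<le> \<bar>y - m\<bar>" for x y
    using \<open>k > 0\<close> by (simp add: f abs_le_square_iff)
  have "is_arg_max f (\<lambda>p. 0 \<le> p) x \<longleftrightarrow> 0 \<le> x \<and> (\<forall>y\<ge>0. \<bar>x - m\<bar> \<le> \<bar>y - m\<bar>)"
    by (auto simp: is_arg_max_def not_less simp flip: le)
  also have "\<dots> \<longleftrightarrow> x = max 0 m"
  proof
    assume *: "0 \<le> x \<and> (\<forall>y\<ge>0. \<bar>x - m\<bar> \<le> \<bar>y - m\<bar>)"
    then have "\<bar>x - m\<bar> \<le> \<bar>max 0 m - m\<bar>" using max.cobounded1 by blast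
    with * show "x = max 0 m" by (auto simp: max_def split: if_splits)
  qed auto
  finally show ?thesis .
qed

lemma profit1_arg_max_iff:
  "is_arg_max (profit1 a r p2) (\<lambda>p. 0 \<le> p) p1 \<longleftrightarrow>
     p1 = max 0 ((1 - r - (1 - a) * (a - p2) - (a - p2)\<^sup>2 / 2) / 2)"
proof (rule is_arg_max_concave_quadratic_iff[where k = 1])
  define m where "m = (1 - r - (1 - a) * (a - p2) - (a - p2)\<^sup>2 / 2) / 2"
  have D: "1 - a + p2 + (a\<^sup>2 - p2\<^sup>2) / 2 = 2 * m + r"
    by (simp add: m_def power2_eq_square field_simps)
  show "profit1 a r p2 p = (m\<^sup>2 + r * (2 * m + r) - r) - 1 * (p - m)\<^sup>2" for p
  proof -
    have "1 - (a + p - p2) + (a\<^sup>2 - p2\<^sup>2) / 2 = 2 * m + r - p" using D by simp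
    then show ?thesis
      unfolding profit1_def by (simp add: power2_eq_square algebra_simps)
  qed
qed simp

text \<open>\<open>p2\<close> is both the price Firm 2 picks and the price consumers expect, so this
  is a fixed-point condition, cleared of the denominator \<open>q\<close>. The corner
  \<open>p2 = 0\<close> is never optimal when \<open>r < 1 - a / 2\<close>, so no \<open>max\<close>
  survives.\<close>

lemma profit2_arg_max_iff:
  assumes "0 \<le> p1" "0 \<le> p2" "p2 < a" "r < 1 - a / 2"
  shows "is_arg_max (profit2 a r p1 p2) (\<lambda>p. 0 \<le> p) p2 \<longleftrightarrow>
     (2 * a - 1 + r) * (a - p2 + p1) = 3 / 2 * (a - p2)\<^sup>2 + 2 * (a - p2) * p1"
proof -
  define q where "q = a + p1 - p2"
  define X where "X = (a - p2) * (a - p2 + 2 * p1) / 2"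
  define m where "m = (1 - a + p2 - r + X / q) / 2"
  have q: "q > 0" using assms by (simp add: q_def)
  have X: "X = q * (2 * m - (1 - a + p2 - r))" using q by (simp add: m_def field_simps)
  have "profit2 a r p1 p2 p = (q * m\<^sup>2 + r * (q * (1 - a + p2) + X) - r * q) - q * (p - m)\<^sup>2" for p
  proof -
    have "profit2 a r p1 p2 p = (p + r) * (q * (1 - a - p + p2) + X) - r * q"
      by (simp add: profit2_def q_def X_def algebra_simps)
    then show ?thesis unfolding X by (simp add: power2_eq_square algebra_simps)
  qed
  then have "is_arg_max (profit2 a r p1 p2) (\<lambda>p. 0 \<le> p) p2 \<longleftrightarrow> p2 = max 0 m"
    by (rule is_arg_max_concave_quadratic_iff[OF q])
  also have "\<dots> \<longleftrightarrow> p2 = m"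
  proof
    assume *: "p2 = max 0 m"
    have "m > 0" if "p2 = 0"
    proof -
      \<comment> \<open>Here \<open>X / q = a * (a + 2 * p1) / (2 * (a + p1))\<close>, so the vertex
        is at least \<open>(1 - a / 2 - r) / 2\<close>.\<close>
      have "X / q \<ge> a / 2"
        using that q assms by (simp add: X_def q_def field_simps)
      then have "0 < 1 - a + p2 - r + X / q" using that \<open>r < 1 - a / 2\<close> by linarith
      then show ?thesis by (simp add: m_def)
    qed
    with * show "p2 = m" by (auto simp: max_def split: if_splits)
  qed (use assms in auto)
  also have "\<dots> \<longleftrightarrow> q * (p2 + r - (1 - a)) = X"
    using q by (auto simp: m_def field_simps)
  also have "\<dots> \<longleftrightarrow> (2 * a - 1 + r) * (a - p2 + p1) = 3 / 2 * (a - p2)\<^sup>2 + 2 * (a - p2) * p1"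
    unfolding q_def X_def by (simp add: power2_eq_square field_simps)
  finally show ?thesis .
qed

text \<open>In the variable \<open>d = a - p2\<close>, with \<open>w = d * p1 / (d + p1)\<close>, the first-order condition of
  Firm 2 reads \<open>4 * a - 2 + 2 * r = 3 * d + w\<close>. It holds with equality since
  \<open>r < 1 - a / 2\<close> forces \<open>p2 > 0\<close>, whereas \<open>p1 = 0\<close> does occur below \<open>r_bar a\<close>.\<close>

definition foc :: "real \<Rightarrow> real \<Rightarrow> real \<Rightarrow> real \<Rightarrow> bool" where
  "foc a r d p \<longleftrightarrow>
     p = max 0 ((1 - r - (1 - a) * d - d\<^sup>2 / 2) / 2) \<and>
     4 * a - 2 + 2 * r = 3 * d + d * p / (d + p)"

lemma focD:
  assumes "foc a r d p"
  shows "0 \<le> p" "1 - r - (1 - a) * d - d\<^sup>2 / 2 \<le> 2 * p"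
    "4 * a - 2 + 2 * r = 3 * d + d * p / (d + p)"
proof -
  show "4 * a - 2 + 2 * r = 3 * d + d * p / (d + p)"
    using assms unfolding foc_def by blast
  have p: "p = max 0 ((1 - r - (1 - a) * d - d\<^sup>2 / 2) / 2)"
    using assms unfolding foc_def by blast
  show "0 \<le> p" "1 - r - (1 - a) * d - d\<^sup>2 / 2 \<le> 2 * p" unfolding p by (auto simp: max_def)
qed

lemma is_equilibrium_iff_foc:
  assumes "0 \<le> p1" "0 \<le> p2" "p2 < a" "r < 1 - a / 2"
  shows "is_equilibrium a r p1 p2 \<longleftrightarrow> foc a r (a - p2) p1"
proof -
  have "a - p2 + p1 > 0" using assms by simp
  then have "(2 * a - 1 + r) * (a - p2 + p1) = 3 / 2 * (a - p2)\<^sup>2 + 2 * (a - p2) * p1 \<longleftrightarrow>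
      4 * a - 2 + 2 * r = (3 * (a - p2)\<^sup>2 + 4 * (a - p2) * p1) / (a - p2 + p1)"
    by (simp add: eq_divide_eq) (simp add: algebra_simps, linarith?)
  also have "(3 * (a - p2)\<^sup>2 + 4 * (a - p2) * p1) / (a - p2 + p1) =
      3 * (a - p2) + (a - p2) * p1 / (a - p2 + p1)"
    using \<open>a - p2 + p1 > 0\<close> by (simp add: field_simps power2_eq_square)
  finally show ?thesis
    unfolding is_equilibrium_def foc_def profit1_arg_max_iff profit2_arg_max_iff[OF assms]
    by simp
qed

section \<open>Existence of a solution of the first-order system\<close>

text \<open>Intermediate value theorem for \<open>h\<close>, the right side of Firm 2's condition
  with Firm 1's best response \<open>P d\<close> substituted. The endpoints \<open>c / 2\<close> and
  \<open>a\<close> stand for \<open>p2 = (1 - r) / 2\<close> and \<open>p2 = 0\<close>.\<close>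

lemma foc_exists:
  assumes a: "1/2 < a" "a < 1" and r: "0 \<le> r" "r < 1 - a / 2"
  obtains d p where "foc a r d p" "a - (1 - r) / 2 \<le> d" "d < a" "0 \<le> p" "p \<le> (1 - r) / 2"
proof -
  define c where "c = 2 * a - 1 + r"
  define P where "P d = max 0 ((1 - r - (1 - a) * d - d\<^sup>2 / 2) / 2)" for d
  define h where "h d = 3 * d + d * P d / (d + P d)" for d
  have c: "0 < c" "c / 2 < a" using a r by (auto simp: c_def)
  have P: "0 \<le> P d" for d by (simp add: P_def)
  \<comment> \<open>The fraction is at most \<open>d\<close>, so
    \<open>h d \<le> 4 * d\<close>.\<close>
  have "h (c / 2) \<le> 2 * c"
  proof -
    have "c / 2 * P (c / 2) / (c / 2 + P (c / 2)) \<le> c / 2"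
      using c P[of "c/2"] by (simp add: divide_le_eq algebra_simps add_pos_nonneg)
    then show ?thesis unfolding h_def by linarith
  qed
  \<comment> \<open>\<open>2 * c < 3 * a\<close> is precisely \<open>r < 1 - a / 2\<close>.\<close>
  moreover have "2 * c < h a"
  proof -
    have "0 \<le> a * P a / (a + P a)" using a P[of a] by simp
    then show ?thesis using a r by (simp add: h_def c_def)
  qed
  moreover have "continuous_on {c / 2..a} h"
    unfolding h_def P_def using c
    by (intro continuous_intros) (auto simp: add_pos_nonneg simp del: max_less_iff_conj
        intro!: add_pos_nonneg[THEN less_imp_neq, symmetric])
  ultimately obtain d where d: "c / 2 \<le> d" "d \<le> a" "h d = 2 * c"
    using IVT'[of h "c / 2" "2 * c" a] c by auto
  show ?thesis
  proof
    show "foc a r d (P d)"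
      using d unfolding foc_def P_def h_def c_def by simp
    show "a - (1 - r) / 2 \<le> d" using d by (simp add: c_def field_simps)
    show "d < a" using d \<open>2 * c < h a\<close> by (metis less_irrefl less_eq_real_def)
    show "0 \<le> P d" by (rule P)
    have "0 \<le> (1 - a) * d" using a c d by simp
    moreover have "0 \<le> d\<^sup>2 / 2" by simp
    ultimately have "1 - r - (1 - a) * d - d\<^sup>2 / 2 \<le> 1 - r" by linarith
    then show "P d \<le> (1 - r) / 2"
      unfolding P_def using a r by (intro max.boundedI divide_right_mono) auto
  qed
qed

section \<open>Comparative statics in the return cost\<close>

lemma parallel_sum_mono:
  fixes d d' p :: real
  assumes "0 < d" "d \<le> d'" "0 \<le> p"
  shows "d * p / (d + p) \<le> d' * p / (d' + p)"
proof -
  have "d * p * (d' + p) \<le> d' * p * (d + p)"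
    using mult_right_mono[OF \<open>d \<le> d'\<close>, of "p * p"] assms by (simp add: algebra_simps)
  then show ?thesis using assms by (simp add: frac_le_eq divide_simps)
qed

text \<open>The fraction equals \<open>p - p\<^sup>2 / (d + p)\<close>, and the subtracted term
  increases with \<open>p\<close>.\<close>

lemma parallel_sum_diff_le:
  fixes d p p' :: real
  assumes "0 < d" "0 \<le> p'" "p' \<le> p"
  shows "d * p / (d + p) - d * p' / (d + p') \<le> p - p'"
proof -
  have "d * p / (d + p) = p - p\<^sup>2 / (d + p)" "d * p' / (d + p') = p' - p'\<^sup>2 / (d + p')"
    using assms by (auto simp: field_simps power2_eq_square)
  moreover have "p'\<^sup>2 / (d + p') \<le> p\<^sup>2 / (d + p)"
  proof -
    have "p'\<^sup>2 * d \<le> p\<^sup>2 * d" "p' * (p' * p) \<le> p * (p' * p)"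
      using assms by (intro mult_right_mono power_mono; simp)+
    then have "p'\<^sup>2 * (d + p) \<le> p\<^sup>2 * (d + p')"
      by (simp add: algebra_simps power2_eq_square)
    then show ?thesis using assms by (simp add: divide_simps)
  qed
  ultimately show ?thesis by simp
qed

text \<open>Clamping at 0 never enlarges an increase; \<open>1 - a + (d + d') / 2\<close> is the
  secant slope of \<open>(1 - a) * d + d\<^sup>2 / 2\<close>.\<close>

lemma foc_price_diff_le:
  assumes "foc a r d p" "foc a r' d' p'"
  shows "2 * p' - 2 * p \<le> max 0 (r - r' + (d - d') * (1 - a + (d + d') / 2))"
proof -
  have "2 * max 0 (y / 2) - 2 * max 0 (x / 2) \<le> max 0 z" if "y - x = z" for x y z :: real
    using that by auto
  moreover have "(1 - r' - (1 - a) * d' - d'\<^sup>2 / 2) - (1 - r - (1 - a) * d - d\<^sup>2 / 2)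
     = r - r' + (d - d') * (1 - a + (d + d') / 2)"
    by (simp add: power2_eq_square field_simps)
  ultimately show ?thesis using assms unfolding foc_def by blast
qed

text \<open>In Firm 2's condition the term \<open>3 * d\<close> dominates: Firm 1's price reacts to
  \<open>d\<close> with slope at most 1/2 in size, and the fraction grows with \<open>d\<close> and
  changes no faster than that price. Allowing \<open>r = r'\<close> lets the lemma serve for
  uniqueness too.\<close>

lemma foc_comparative_statics:
  assumes foc: "foc a r d p" "foc a r' d' p'" and "r \<le> r'" "a < 1"
    and d: "0 < d" "d \<le> a" and d': "0 < d'" "d' \<le> a"
  shows "d \<le> d'" "d' - d \<le> r' - r" "p' \<le> p"
proof -
  define w where "w d p = d * p / (d + p)" for d p :: real
  have p: "0 \<le> p" "0 \<le> p'" using foc focD(1) by auto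
  have \<Delta>: "2 * r' - 2 * r = 3 * d' - 3 * d + (w d' p' - w d p)"
    using focD(3)[OF foc(1)] focD(3)[OF foc(2)] unfolding w_def[symmetric] by linarith
  have s: "0 \<le> 1 - a + (d + d') / 2" "1 - a + (d + d') / 2 \<le> 1"
    using d d' \<open>a < 1\<close> by auto
  show dd: "d \<le> d'"
  proof (rule ccontr)
    assume "\<not> d \<le> d'"
    then have "d' < d" by simp
    then have "(d - d') * (1 - a + (d + d') / 2) \<le> d - d'"
      using mult_left_mono[OF s(2), of "d - d'"] by simp
    with foc_price_diff_le[OF foc] have pp: "2 * p' - 2 * p \<le> d - d'"
      using \<open>r \<le> r'\<close> \<open>d' < d\<close> by linarith
    have "w d' p' \<le> w d p'"
      unfolding w_def using d' \<open>d' < d\<close> p by (intro parallel_sum_mono) auto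
    moreover have "w d p' - w d p \<le> max 0 (p' - p)"
    proof (cases "p \<le> p'")
      case True
      then show ?thesis
        unfolding w_def using parallel_sum_diff_le[OF d(1) p(1) True] by simp
    next
      case False
      \<comment> \<open>\<open>w\<close> is symmetric, so monotonicity in the first argument applies
        to the price; \<open>p' = 0\<close> is split off because that argument must be
        positive.\<close>
      then have "w d p' \<le> w d p"
        using parallel_sum_mono[of p' p d] parallel_sum_mono[of p d d] d p
        by (cases "p' = 0") (auto simp: w_def mult.commute add.commute)
      then show ?thesis by simp
    qed
    ultimately show False using \<Delta> pp \<open>r \<le> r'\<close> \<open>d' < d\<close> by linarith
  qed
  have "(d - d') * (1 - a + (d + d') / 2) \<le> 0"
    using dd s by (intro mult_nonpos_nonneg) auto
  with foc_price_diff_le[OF foc] show pp: "p' \<le> p"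
    using \<open>r \<le> r'\<close> by linarith
  have "(d' - d) * (1 - a + (d' + d) / 2) \<le> d' - d"
    using dd s mult_left_mono[OF s(2), of "d' - d"] by (simp add: add.commute)
  with foc_price_diff_le[OF foc(2,1)] have "2 * p - 2 * p' \<le> r' - r + (d' - d)"
    using \<open>r \<le> r'\<close> dd by linarith
  moreover have "w d p' \<le> w d' p'" "w d p - w d p' \<le> p - p'"
    unfolding w_def using d dd p pp by (auto intro: parallel_sum_mono parallel_sum_diff_le)
  \<comment> \<open>The bounds combine to 5/2 times this inequality.\<close>
  ultimately show "d' - d \<le> r' - r" using \<Delta> by linarith
qed

section \<open>Uniqueness of the equilibrium\<close>

text \<open>Comparing two solutions at the same \<open>r\<close> in both directions forces them to
  coincide, so the definite description in \<open>equilibrium\<close> denotes the solution found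
  above.\<close>

lemma equilibrium_foc:
  assumes a: "1/2 < a" "a < 1" and r: "0 \<le> r" "r < 1 - a / 2"
  obtains p1 p2 where "equilibrium a r = (p1, p2)" "foc a r (a - p2) p1"
    "is_arg_max (profit1 a r p2) (\<lambda>p. 0 \<le> p) p1"
    "0 \<le> p1" "0 < p2" "p2 \<le> (1 - r) / 2"
proof -
  obtain d p where dp: "foc a r d p" "a - (1 - r) / 2 \<le> d" "d < a" "0 \<le> p" "p \<le> (1 - r) / 2"
    using foc_exists[OF assms] .
  have lt: "x < a" if "x \<le> (1 - r) / 2" for x using that a r by simp
  define Q where "Q = (\<lambda>(p1, p2). p1 \<in> {0..(1 - r) / 2} \<and> p2 \<in> {0..(1 - r) / 2} \<and>
    is_equilibrium a r p1 p2)"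
  have p2: "a - d \<le> (1 - r) / 2" using dp by linarith
  then have "0 < d" using lt by fastforce
  then have Q: "Q (p, a - d)"
    using dp p2 r is_equilibrium_iff_foc[of p "a - d" a r] by (simp add: Q_def)
  have "z = (p, a - d)" if "Q z" for z
  proof -
    obtain p1 p2 where z: "z = (p1, p2)" by fastforce
    with that have b: "0 \<le> p1" "0 \<le> p2" "p2 \<le> (1 - r) / 2" "is_equilibrium a r p1 p2"
      by (auto simp: Q_def)
    with lt r have f: "foc a r (a - p2) p1"
      using is_equilibrium_iff_foc[of p1 p2 a r] by auto
    have pos: "0 < d" "0 < a - p2" using lt[of p2] \<open>0 < d\<close> b by auto
    have "d \<le> a - p2" "p1 \<le> p" "a - p2 \<le> d" "p \<le> p1"
      using foc_comparative_statics[OF dp(1) f] foc_comparative_statics[OF f dp(1)] a pos b dp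
      by auto
    then show ?thesis using z by simp
  qed
  then have "equilibrium a r = (p, a - d)"
    unfolding equilibrium_def Q_def[symmetric] by (rule the_equality[where P = Q, OF Q])
  then show ?thesis
    using that[of p "a - d"] dp p2 Q by (auto simp: Q_def is_equilibrium_def)
qed

section \<open>Profit of Firm 1\<close>

text \<open>At \<open>r\<close> Firm 1 could also charge \<open>p1'\<close>. At that price the gain
  over \<open>r'\<close> splits into demand kept by the higher \<open>p2\<close> and return cost
  saved on the share \<open>1 - D p2'\<close> sent back.\<close>

lemma eq_profit1_strict_antimono:
  assumes a: "1/2 < a" "a < 1" and r: "0 \<le> r" "r < r'" "r' < 1 - a / 2"
  shows "eq_profit1 a r' < eq_profit1 a r"
proof -
  have r_less: "r < 1 - a / 2" "0 \<le> r'" using r by auto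
  obtain p1 p2 where e: "equilibrium a r = (p1, p2)" "foc a r (a - p2) p1"
    "is_arg_max (profit1 a r p2) (\<lambda>p. 0 \<le> p) p1" "0 \<le> p1" "0 < p2" "p2 \<le> (1 - r) / 2"
    using equilibrium_foc[OF a r(1) r_less(1)] .
  obtain p1' p2' where e': "equilibrium a r' = (p1', p2')" "foc a r' (a - p2') p1'"
    "is_arg_max (profit1 a r' p2') (\<lambda>p. 0 \<le> p) p1'" "0 \<le> p1'" "0 < p2'" "p2' \<le> (1 - r') / 2"
    using equilibrium_foc[OF a r_less(2) r(3)] .
  have "a - p2 \<le> a - p2'"
    using foc_comparative_statics[OF e(2) e'(2)] a r e e' by auto
  then have p2: "p2' \<le> p2" by simp
  define D where "D p2 = 1 - (a + p1' - p2) + (a\<^sup>2 - p2\<^sup>2) / 2" for p2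
  have "D p2 - D p2' = (p2 - p2') * (1 - (p2 + p2') / 2)"
    by (simp add: D_def power2_eq_square field_simps)
  moreover have "0 \<le> (p2 - p2') * (1 - (p2 + p2') / 2)"
    using p2 e e' r by (intro mult_nonneg_nonneg) auto
  ultimately have "0 \<le> (p1' + r) * (D p2 - D p2')"
    using e' r by (intro mult_nonneg_nonneg) auto
  \<comment> \<open>Strictness: a positive share of product 1 is returned.\<close>
  moreover have "D p2' < 1"
  proof -
    have "1 - D p2' = p1' + (a - p2') * (1 - (a + p2') / 2)"
      by (simp add: D_def power2_eq_square field_simps)
    moreover have "0 < (a - p2') * (1 - (a + p2') / 2)"
      using a r e' by (intro mult_pos_pos) auto
    ultimately show ?thesis using e' by simp
  qed
  then have "0 < (r' - r) * (1 - D p2')" using r by simp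
  moreover have "profit1 a r p2 p1' - profit1 a r' p2' p1' =
      (p1' + r) * (D p2 - D p2') + (r' - r) * (1 - D p2')"
    unfolding profit1_def D_def[symmetric] by (simp add: algebra_simps)
  moreover have "profit1 a r p2 p1' \<le> profit1 a r p2 p1"
    using e(3) e'(4) by (auto simp: is_arg_max_def not_less)
  ultimately show ?thesis by (simp add: eq_profit1_def e(1) e'(1))
qed

section \<open>Profit of Firm 2\<close>

text \<open>Eliminating \<open>r\<close> from the two conditions gives \<open>p1 - p2\<close> the
  sign of \<open>2 * a - 1 - d - v\<close>. But \<open>p1 > p2\<close> would make \<open>v\<close>
  at least \<open>p2 / (d + p2) = p2 / a\<close>, which is too large.\<close>

lemma foc_price1_le_price2:
  assumes foc: "foc a r (a - p2) p1" and "1/2 < a" "a < 1" "0 < p2" "p2 < a"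
  shows "p1 \<le> p2"
proof (rule ccontr)
  assume "\<not> p1 \<le> p2"
  define d where "d = a - p2"
  have d: "0 < d" "d < a" using assms by (auto simp: d_def)
  have p: "a - d < p1" "0 < p1" using \<open>\<not> p1 \<le> p2\<close> assms by (auto simp: d_def)
  define v where "v = p1 / (d + p1)"
  have f: "2 * p1 = 1 - r - (1 - a) * d - d\<^sup>2 / 2" "4 * a - 2 + 2 * r = 3 * d + d * v"
    using foc p unfolding foc_def d_def[symmetric] v_def
    by (auto simp: max_def split: if_splits)
  have "2 * p1 - 2 * (a - d) = d * (2 * a - 1 - d - v) / 2"
    using f by (simp add: power2_eq_square field_simps)
  with p d have v: "v < 2 * a - 1 - d" by (smt (verit) divide_nonpos_pos mult_nonneg_nonpos)
  have "(a - d) / a \<le> v"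
  proof -
    have "(a - d) * d \<le> p1 * d" using p d by (intro mult_right_mono) auto
    then show ?thesis using p d assms by (simp add: v_def divide_simps algebra_simps)
  qed
  moreover have "(a - d) / a - (2 * a - 1 - d) = (1 - a) * (2 - d / a)"
    using assms by (simp add: field_simps)
  moreover have "0 \<le> (1 - a) * (2 - d / a)"
    using assms d by (intro mult_nonneg_nonneg) (auto simp: field_simps)
  ultimately show False using v by linarith
qed

text \<open>Since \<open>p2 \<le> 1 - p2 - r\<close>, a comparison with
  \<open>(a + p1 - p2) * p2\<close> suffices, which amounts to bounding \<open>p2 - p1\<close>. Firm
  1's condition gives \<open>p2 - p1 \<le> d / 2\<close>, and Firm 2's gives
  \<open>d \<le> 2 / 3 * (2 * a - 1 + r)\<close>.\<close>

lemma foc_margin: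
  assumes foc: "foc a r (a - p2) p1" and a: "1/2 < a" "a < 1" and r: "0 \<le> r" "r < 1"
    and p2: "0 < p2" "p2 \<le> (1 - r) / 2" "p2 < a"
  shows "p2 * (1 - a) - r * a < (a + p1 - p2) * (1 - p2 - r)"
proof -
  define d where "d = a - p2"
  have d: "0 < d" "d < a" using p2 by (auto simp: d_def)
  have p1: "0 \<le> p1" "1 - r - (1 - a) * d - d\<^sup>2 / 2 \<le> 2 * p1"
    using focD(1,2)[OF foc] unfolding d_def by auto
  have "d * (1 - a + d / 2) \<le> d * 1"
    using d a by (intro mult_left_mono) auto
  then have "(1 - a) * d + d\<^sup>2 / 2 \<le> d" by (simp add: power2_eq_square algebra_simps)
  then have gap: "2 * (p2 - p1) \<le> d" using p1 p2 by simp
  have "0 \<le> d * p1 / (d + p1)" using d p1 by simp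
  then have "3 / 2 * d \<le> 2 * a - 1 + r" using focD(3)[OF foc] unfolding d_def by simp
  with gap have "p2 - p1 - (2 * a - 1) \<le> r / 3 - 2 / 3 * (2 * a - 1)"
    by (simp add: field_simps)
  then have "p2 * (p2 - p1 - (2 * a - 1)) \<le> p2 * (r / 3 - 2 / 3 * (2 * a - 1))"
    using p2 by (intro mult_left_mono) auto
  also have "\<dots> = p2 * r / 3 - 2 / 3 * (p2 * (2 * a - 1))"
    by (simp add: field_simps)
  also have "\<dots> < r * a"
  proof -
    have "p2 * r \<le> a * r" using p2 r by (intro mult_right_mono) auto
    moreover have "0 \<le> a * r" using a r by simp
    moreover have "0 < p2 * (2 * a - 1)" using a p2 by simp
    ultimately show ?thesis by (simp only: mult.commute[of r a])
  qed
  finally have "p2 * (1 - a) - r * a < (a + p1 - p2) * p2" by (simp add: algebra_simps)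
  also have "\<dots> \<le> (a + p1 - p2) * (1 - p2 - r)"
    using p2 p1 by (intro mult_left_mono) auto
  finally show ?thesis .
qed

text \<open>The left side is Firm 2's demand at \<open>p = p2\<close>. Demand falls in
  \<open>p\<close> at rate \<open>a + p1 - p2\<close>, so at the optimum it equals this rate times
  the markup \<open>p2 + r\<close>.\<close>

lemma foc_demand2:
  assumes "foc a r (a - p2) p1" "0 \<le> p1" "p2 < a"
  shows "(a + p1 - p2) * (1 - a) + (a - p2) * (a - p2 + 2 * p1) / 2 = (a + p1 - p2) * (p2 + r)"
proof -
  define d where "d = a - p2"
  have "d > 0" "a = d + p2" using assms by (auto simp: d_def)
  moreover have "(2 * a - 1 + r) * (d + p1) = 3 / 2 * d\<^sup>2 + 2 * d * p1"
    using focD(3)[OF assms(1)] \<open>d > 0\<close> \<open>0 \<le> p1\<close> unfolding d_def[symmetric]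
    by (simp add: add_pos_nonneg divide_simps split: if_splits)
      (simp add: power2_eq_square algebra_simps)
  ultimately show ?thesis
    by (simp add: field_simps power2_eq_square)
qed

lemma eq_profit2_strict_antimono:
  assumes a: "1/2 < a" "a < 1" and r: "0 \<le> r" "r < r'" "r' < 1 - a / 2"
  shows "eq_profit2 a r' < eq_profit2 a r"
proof -
  have r_less: "r < 1 - a / 2" "0 \<le> r'" using r by auto
  obtain p1 p2 where e: "equilibrium a r = (p1, p2)" "foc a r (a - p2) p1"
    "is_arg_max (profit1 a r p2) (\<lambda>p. 0 \<le> p) p1" "0 \<le> p1" "0 < p2" "p2 \<le> (1 - r) / 2"
    using equilibrium_foc[OF a r(1) r_less(1)] .
  obtain p1' p2' where e': "equilibrium a r' = (p1', p2')" "foc a r' (a - p2') p1'"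
    "is_arg_max (profit1 a r' p2') (\<lambda>p. 0 \<le> p) p1'" "0 \<le> p1'" "0 < p2'" "p2' \<le> (1 - r') / 2"
    using equilibrium_foc[OF a r_less(2) r(3)] .
  have lt: "p2 < a" "p2' < a" "r < 1" "r' < 1" using a r e e' by auto
  define \<Delta> \<delta> \<eta> where defs: "\<Delta> = r' - r" "\<delta> = p2 - p2'" "\<eta> = p1 - p1'"
  have cs: "0 \<le> \<delta>" "\<delta> \<le> \<Delta>" "0 \<le> \<eta>" "0 < \<Delta>"
    using foc_comparative_statics[OF e(2) e'(2)] a r e e' lt by (auto simp: defs)
  have "p1 \<le> p2" using foc_price1_le_price2[OF e(2)] a e lt by auto
  define q where "q = a + p1 - p2"
  have "0 < q * (1 - p2 - r)" using e lt a r by (simp add: q_def)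
  moreover have "p2 * (1 - a) - r * a < q * (1 - p2 - r)"
    unfolding q_def using foc_margin[OF e(2)] a e lt r by auto
  \<comment> \<open>Linear in \<open>\<delta>\<close> and positive at both ends,
    \<open>\<delta> = 0\<close> and \<open>\<delta> = \<Delta>\<close>.\<close>
  ultimately have "0 < \<Delta> * (q * (1 - p2 - r)) - \<delta> * (p2 * (1 - a) - r * a)"
    (is "0 < ?main") using cs
    by (smt (verit) mult_left_mono mult_right_mono mult_nonneg_nonpos mult_strict_left_mono mult_pos_pos)
  \<comment> \<open>The loss from Firm 1's price cut: \<open>profit2\<close> is affine in
    \<open>p1\<close>, with slope \<open>p2 * (1 - p2 - r)\<close> at \<open>p = p2\<close>.\<close>
  moreover have "0 \<le> \<eta> * (p2' * (1 - p2' - r'))"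
    using cs e' lt by (intro mult_nonneg_nonneg) auto
  moreover have "0 \<le> \<delta> * (\<delta> * (1 - (p2' + r') / 2) + (\<Delta> - \<delta>) * (p2 - p1))"
    using cs e' lt \<open>p1 \<le> p2\<close> by (intro mult_nonneg_nonneg add_nonneg_nonneg) auto
  moreover have "profit2 a r p1 p2 p2 - profit2 a r' p1' p2' p2' = ?main
      + \<eta> * (p2' * (1 - p2' - r'))
      + \<delta> * (\<delta> * (1 - (p2' + r') / 2) + (\<Delta> - \<delta>) * (p2 - p1))"
  \<comment> \<open>Firm 2's first-order condition enters only at \<open>r\<close>; all remainder terms of second order have a sign
    because \<open>\<delta> \<le> \<Delta>\<close> and \<open>p1 \<le> p2\<close>, so no passage to derivatives in \<open>r\<close> is needed.\<close>
  proof -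
    define S where "S = (a + p1 - p2) * (1 - a) + (a - p2) * (a - p2 + 2 * p1) / 2"
    have S: "S = q * (p2 + r)"
      using foc_demand2[OF e(2)] e lt by (simp add: S_def q_def)
    \<comment> \<open>A polynomial identity: the error is a multiple of the residual of Firm 2's
      first-order condition.\<close>
    have "profit2 a r p1 p2 p2 - profit2 a r' p1' p2' p2' - (?main
      + \<eta> * (p2' * (1 - p2' - r'))
      + \<delta> * (\<delta> * (1 - (p2' + r') / 2) + (\<Delta> - \<delta>) * (p2 - p1)))
      = (\<delta> - \<Delta>) * (S - q * (p2 + r))"
      unfolding profit2_def defs q_def S_def by (simp add: power2_eq_square field_simps)
    then show ?thesis using S by simp
  qed
  ultimately show ?thesis by (simp add: eq_profit2_def e(1) e'(1))
qed

section \<open>Parameter range and conclusion\<close>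

text \<open>The radicand is \<open>9 - 4 * a * (1 - a)\<close>, below 9, and also
  \<open>(2 * a - 1)\<^sup>2 + 8\<close>.\<close>

lemma r_bar_less:
  assumes "1/2 < a" "a < 1"
  shows "r_bar a < 1 - a / 2" "0 < r_bar a"
proof -
  have "a * a < a * 1" using assms by (intro mult_strict_left_mono) auto
  then have "4 * a\<^sup>2 - 4 * a + 9 < 3\<^sup>2" by (simp add: power2_eq_square)
  then have "sqrt (4 * a\<^sup>2 - 4 * a + 9) < 3" by (intro real_less_lsqrt) auto
  then show "r_bar a < 1 - a / 2" by (simp add: r_bar_def field_simps)
  have "(2 * a - 1)\<^sup>2 < 4 * a\<^sup>2 - 4 * a + 9" by (simp add: power2_eq_square algebra_simps)
  then have "2 * a - 1 < sqrt (4 * a\<^sup>2 - 4 * a + 9)" by (rule real_less_rsqrt)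
  then show "0 < r_bar a" by (simp add: r_bar_def)
qed

lemma reservation_value_bounds:
  assumes "s \<in> {0<..<1/8}"
  shows "1/2 < reservation_value s" "reservation_value s < 1"
proof -
  have "2 * s < (1/2)\<^sup>2" using assms by (simp add: power2_eq_square)
  then have "sqrt (2 * s) < 1/2" by (intro real_less_lsqrt) auto
  then show "1/2 < reservation_value s" by (simp add: reservation_value_def)
  show "reservation_value s < 1" using assms by (simp add: reservation_value_def)
qed

theorem corollary1:
  shows
    "(\<forall>s\<in>{0<..<1/8}.
        strict_antimono_on {0..r_bar (reservation_value s)} (eq_profit1 (reservation_value s)))
   \<and> (\<exists>s_bar\<in>{0<..<1/8}. \<forall>s\<in>{0<..<s_bar}.
        strict_antimono_on {0..r_bar (reservation_value s)} (eq_profit2 (reservation_value s)))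
   \<and> (\<forall>s\<in>{0<..<1/8}. \<exists>r_tilde. 0 \<le> r_tilde \<and> r_tilde < r_bar (reservation_value s) \<and>
        strict_antimono_on {r_tilde..r_bar (reservation_value s)} (eq_profit2 (reservation_value s)))
   \<and> (\<forall>s\<in>{0<..<1/8}.
        strict_antimono_on {0..r_bar (reservation_value s)}
          (\<lambda>r. eq_profit1 (reservation_value s) r + eq_profit2 (reservation_value s) r))"
proof -
  have decr: "eq_profit1 (reservation_value s) r' < eq_profit1 (reservation_value s) r"
      "eq_profit2 (reservation_value s) r' < eq_profit2 (reservation_value s) r"
    if "s \<in> {0<..<1/8}" "0 \<le> r" "r < r'" "r' \<le> r_bar (reservation_value s)" for s r r'
    using that r_bar_less(1)[OF reservation_value_bounds[OF that(1)]]
    by (auto intro!: eq_profit1_strict_antimono eq_profit2_strict_antimono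
        reservation_value_bounds)
  have p1: "strict_antimono_on {0..r_bar (reservation_value s)} (eq_profit1 (reservation_value s))"
    and p2: "strict_antimono_on {0..r_bar (reservation_value s)} (eq_profit2 (reservation_value s))"
    and p12: "strict_antimono_on {0..r_bar (reservation_value s)}
      (\<lambda>r. eq_profit1 (reservation_value s) r + eq_profit2 (reservation_value s) r)"
    if "s \<in> {0<..<1/8}" for s
    using decr[OF that] by (auto intro!: monotone_onI add_strict_mono)
  \<comment> \<open>Any threshold below 1/8 would do, as \<open>p2\<close> covers every
    \<open>s\<close>; likewise \<open>r_tilde = 0\<close> below, given \<open>r_bar\<close>
    positive.\<close>
  have "\<exists>s_bar\<in>{0<..<1/8}. \<forall>s\<in>{0<..<s_bar}.
      strict_antimono_on {0..r_bar (reservation_value s)} (eq_profit2 (reservation_value s))"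
    by (rule bexI[where x = "1/16"]) (auto intro: p2)
  moreover have "0 < r_bar (reservation_value s)" if "s \<in> {0<..<1/8}" for s
    using r_bar_less(2) reservation_value_bounds[OF that] by auto
  ultimately show ?thesis
    using p1 p2 p12 by (auto intro!: exI[where x = 0])
qed

end
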